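(* Let $a(n)$ be the number of ways of having a total of $n$ coins in your two pockets (each coin being a penny, a nickel, a dime or a quarter, i.e. worth $1$, $5$, $10$ or $25$ cents), so that the amounts of money in the two pockets are identical. Then, as formal power series, $$\sum_{n=0}^{\infty} a(n)\,t^n=\frac{P(t)}{Q(t)},$$ where $$\begin{aligned}P(t)={}&t^{54}+t^{53}+3t^{52}+4t^{51}+9t^{50}+15t^{49}+25t^{48}+37t^{47}+54t^{46}+76t^{45}+101t^{44}+128t^{43}\\&+158t^{42}+190t^{41}+226t^{40}+256t^{39}+290t^{38}+318t^{37}+353t^{36}+372t^{35}+394t^{34}+405t^{33}+425t^{32}\\&+431t^{31}+439t^{30}+438t^{29}+448t^{28}+448t^{27}+448t^{26}+438t^{25}+439t^{24}+431t^{23}+425t^{22}+405t^{21}\\&+394t^{20}+372t^{19}+353t^{18}+318t^{17}+290t^{16}+256t^{15}+226t^{14}+190t^{13}+158t^{12}+128t^{11}+101t^{10}\\&+76t^{9}+54t^{8}+37t^{7}+25t^{6}+15t^{5}+9t^{4}+4t^{3}+3t^{2}+t+1\end{aligned}$$ and $$\begin{aligned}Q(t)={}&(1-t)^7(1+t)^5(t^2+t+1)^3(t^2-t+1)^2\\&\cdot(t^{12}+t^{11}+t^{10}+t^9+t^8+t^7+t^6+t^5+t^4+t^3+t^2+t+1)\\&\cdot(t^{12}-t^{11}+t^{10}-t^9+t^8-t^7+t^6-t^5+t^4-t^3+t^2-t+1)\\&\cdot(t^{10}+t^9+t^8+t^7+t^6+t^5+t^4+t^3+t^2+t+1)\,(t^6+t^5+t^4+t^3+t^2+t+1).\end{aligned}$$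 Furthermore, $a(n)$ is a quasi-polynomial in $n$, and asymptotically (as $n\to\infty$) $$a(n)=\frac{5821}{311351040}\,n^6+O(n^5).$$ Finally, $a(10^{100})$ is the integer whose decimal expansion is the concatenation, in this order, of the following eight blocks of digits: 1869593883482772371661260550149439038327927216816105704994593883482772371661260 5501494390383279272213031310253532475754697976920199142421364643586865809088031 3102535324757546979769201991424213646436436428797539908651019762130873241984353 0954642065753176864287975399086510197621308732419843530954646363924141701919479 6972574750352528130305908083685861463639241417019194796972574750352528130305908 1017544132821910599688377466155243933021710799488577266355044132821910599688377 4661552439330217107995247753069975292197514419736641958864181086403308625530847 7530699752921975144197366419588641810864035 The first $31$ terms $a(0),a(1),\dots,a(30)$ are: $1, 0, 4, 2, 12, 12, 34, 40, 85, 108, 190, 250, 394, 516, 762, 984, 1385, 1764, 2396, 2998, 3966, 4886, 6316, 7684, 9739, 11706, 14594, 17358, 21320, 25134, 30470$.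
   Context: The two pockets are distinguishable (left and right), and coins of the same denomination are indistinguishable. Thus $a(n)$ is the number of $8$-tuples $(p_1,p_5,p_{10},p_{25},q_1,q_5,q_{10},q_{25})$ of non-negative integers with $p_1+p_5+p_{10}+p_{25}+q_1+q_5+q_{10}+q_{25}=n$ and $p_1+5p_5+10p_{10}+25p_{25}=q_1+5q_5+10q_{10}+25q_{25}$. Equivalently, $a(n)$ is the coefficient of $t^n z^0$ in $$\prod_{c\in\{1,5,10,25\}}\frac{1}{(1-tz^{c})(1-tz^{-c})},$$ expanded as a formal power series in $t$ whose coefficients are Laurent polynomials in $z$. A function $a:\mathbb{Z}_{\ge 0}\to\mathbb{Q}$ is a quasi-polynomial if there are a positive integer $N$ (a period) and polynomials $f_0,\dots,f_{N-1}\in\mathbb{Q}[x]$ such that $a(n)=f_i(n)$ whenever $n\equiv i \pmod N$. *)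

theory Defs
  imports
    "HOL-Computational_Algebra.Computational_Algebra"
    "HOL-Library.Landau_Symbols"
begin

text \<open>
  The components \<open>p1, p5, p10, p25\<close> count the pennies, nickels, dimes and quarters in the
  left pocket, and \<open>q1, q5, q10, q25\<close> those in the right pocket. The pockets are
  distinguishable; coins of the same denomination are not.
\<close>

definition pocket_distributions ::
  "nat \<Rightarrow> (nat \<times> nat \<times> nat \<times> nat \<times> nat \<times> nat \<times> nat \<times> nat) set" where
  "pocket_distributions n =
     {(p1, p5, p10, p25, q1, q5, q10, q25).
        p1 + p5 + p10 + p25 + q1 + q5 + q10 + q25 = n \<and>
        p1 + 5 * p5 + 10 * p10 + 25 * p25 = q1 + 5 * q5 + 10 * q10 + 25 * q25}"

definition pocket_count :: "nat \<Rightarrow> nat" where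
  "pocket_count n = card (pocket_distributions n)"

definition quasi_polynomial :: "(nat \<Rightarrow> rat) \<Rightarrow> bool" where
  "quasi_polynomial a \<longleftrightarrow>
     (\<exists>N > 0. \<exists>f :: nat \<Rightarrow> rat poly.
        \<forall>i < N. \<forall>n. n mod N = i \<longrightarrow> a n = poly (f i) (of_nat n))"

definition pocket_numerator :: "'a::comm_ring_1 \<Rightarrow> 'a" where
  "pocket_numerator t =
      t^54 + t^53 + 3*t^52 + 4*t^51 + 9*t^50 + 15*t^49 + 25*t^48 + 37*t^47 + 54*t^46 + 76*t^45 + 101*t^44 +
      128*t^43 + 158*t^42 + 190*t^41 + 226*t^40 + 256*t^39 + 290*t^38 + 318*t^37 + 353*t^36 + 372*t^35 + 394*t^34 + 405*t^33 +
      425*t^32 + 431*t^31 + 439*t^30 + 438*t^29 + 448*t^28 + 448*t^27 + 448*t^26 + 438*t^25 + 439*t^24 + 431*t^23 + 425*t^22 +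
      405*t^21 + 394*t^20 + 372*t^19 + 353*t^18 + 318*t^17 + 290*t^16 + 256*t^15 + 226*t^14 + 190*t^13 + 158*t^12 + 128*t^11 +
      101*t^10 + 76*t^9 + 54*t^8 + 37*t^7 + 25*t^6 + 15*t^5 + 9*t^4 + 4*t^3 + 3*t^2 + t + 1"

definition pocket_denominator :: "'a::comm_ring_1 \<Rightarrow> 'a" where
  "pocket_denominator t =
      (1 - t)^7 * (1 + t)^5 * (t^2 + t + 1)^3 * (t^2 - t + 1)^2 *
      (t^12 + t^11 + t^10 + t^9 + t^8 + t^7 + t^6 + t^5 + t^4 + t^3 + t^2 + t + 1) *
      (t^12 - t^11 + t^10 - t^9 + t^8 - t^7 + t^6 - t^5 + t^4 - t^3 + t^2 - t + 1) *
      (t^10 + t^9 + t^8 + t^7 + t^6 + t^5 + t^4 + t^3 + t^2 + t + 1) *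
      (t^6 + t^5 + t^4 + t^3 + t^2 + t + 1)"

end

theory Submission
  imports Defs
begin

text \<open>
  Let \<open>A k\<close> be the generating function, by number of coins, of the distributions in which the left
  pocket holds \<open>k\<close> cents more than the right one. Undoing the addition of a pair of coins of value
  \<open>c\<close>, one for each pocket, is the operator
  \<open>f \<mapsto> (1 + X^2) f k - X f (k - c) - X f (k + c)\<close>, which is injective on families of power series.
  Applying it for \<open>c = 25, 10, 5, 1\<close> turns \<open>A\<close> into the family that is \<open>1\<close> at \<open>0\<close> and \<open>0\<close> elsewhere,
  so \<open>A\<close> can be recovered by inverting the four operators one by one. If pennies are inverted first,
  only multiples of \<open>5\<close> matter afterwards, and the family obtained at each step is a combination of
  powers of \<open>X\<close> with exponents linear in \<open>\<bar>k\<bar>\<close>, where the parity of \<open>k\<close> matters once dimes are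
  involved.

  For the other claims, the rational function is decomposed into partial fractions with denominators
  \<open>(1 - X^6)^7\<close>, \<open>1 - X^26\<close>, \<open>1 - X^11\<close> and \<open>1 - X^7\<close>; each has explicit coefficients, and only
  the first contributes more than a bounded periodic function.
\<close>

section \<open>Families of distributions and coin operators\<close>

abbreviation (input) X :: "rat fps" where "X \<equiv> fps_X"

text \<open>\<open>S n k\<close> stands for the arrangements of \<open>n\<close> coins with net
  value \<open>k\<close>. The new count \<open>p\<close> goes in front, so that nesting reproduces
  the tuples of \<open>pocket_distributions\<close>.\<close>

definition add_coin :: "int \<Rightarrow> (nat \<Rightarrow> int \<Rightarrow> 'a set) \<Rightarrow> nat \<Rightarrow> int \<Rightarrow> (nat \<times> 'a) set" where
  "add_coin c S n k = {(p, x). \<exists>m. n = p + m \<and> x \<in> S m (k - c * int p)}"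

definition only_coin :: "int \<Rightarrow> nat \<Rightarrow> int \<Rightarrow> nat set" where
  "only_coin c n k = {p. p = n \<and> k = c * int p}"

definition count_gf :: "(nat \<Rightarrow> int \<Rightarrow> 'a set) \<Rightarrow> int \<Rightarrow> rat fps" where
  "count_gf S k = Abs_fps (\<lambda>n. of_nat (card (S n k)))"

definition remove_coin :: "int \<Rightarrow> (int \<Rightarrow> rat fps) \<Rightarrow> int \<Rightarrow> rat fps" where
  "remove_coin c f k = f k - X * f (k - c)"

definition remove_pair :: "int \<Rightarrow> (int \<Rightarrow> rat fps) \<Rightarrow> int \<Rightarrow> rat fps" where
  "remove_pair c f k = (1 + X\<^sup>2) * f k - X * f (k - c) - X * f (k + c)"

lemma add_coin_eq_Sigma: "add_coin c S n k = (SIGMA p:{..n}. S (n - p) (k - c * int p))"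
  by (force simp: add_coin_def)

lemma finite_only_coin: "finite (only_coin c n k)"
  by (rule finite_subset[of _ "{n}"]) (auto simp: only_coin_def)

lemma finite_add_coin: "(\<And>n k. finite (S n k)) \<Longrightarrow> finite (add_coin c S n k)"
  by (simp add: add_coin_eq_Sigma)

lemma remove_coin_only_coin:
  "remove_coin c (count_gf (only_coin c)) = (\<lambda>k. if k = 0 then 1 else 0)"
proof (rule ext, rule fps_ext)
  fix k :: int and n :: nat
  have card: "card (only_coin c n k) = (if k = c * int n then 1 else 0)" for n k
  proof (cases "k = c * int n")
    case True
    then have "only_coin c n k = {n}" by (auto simp: only_coin_def)
    then show ?thesis using True by simp
  qed (auto simp: only_coin_def)
  show "fps_nth (remove_coin c (count_gf (only_coin c)) k) n =
        fps_nth (if k = 0 then 1 else 0) n"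
    by (cases n) (auto simp: remove_coin_def count_gf_def card algebra_simps)
qed

lemma remove_coin_add_coin:
  assumes "\<And>n k. finite (S n k)"
  shows "remove_coin c (count_gf (add_coin c S)) = count_gf S"
proof (rule ext, rule fps_ext)
  fix k :: int and n :: nat
  have card: "card (add_coin c S n k) = (\<Sum>p\<le>n. card (S (n - p) (k - c * int p)))" for n k
    using assms by (simp add: add_coin_eq_Sigma)
  \<comment> \<open>The term \<open>p = 0\<close> has no coin of value \<open>c\<close>; in the
    others one such coin is deleted, which lowers the number of coins by 1 and the value by
    \<open>c\<close>.\<close>
  have card_Suc: "card (add_coin c S (Suc n) k) = card (S (Suc n) k) + card (add_coin c S n (k - c))" for n
    by (simp add: card sum.atMost_Suc_shift algebra_simps del: sum.atMost_Suc)
  show "fps_nth (remove_coin c (count_gf (add_coin c S)) k) n = fps_nth (count_gf S k) n"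
  proof (cases n)
    case 0
    then show ?thesis by (simp add: remove_coin_def count_gf_def card)
  next
    case (Suc i)
    then show ?thesis by (simp add: remove_coin_def count_gf_def card_Suc)
  qed
qed

lemma remove_coin_commute: "remove_coin c (remove_coin d f) = remove_coin d (remove_coin c f)"
  by (rule ext) (simp add: remove_coin_def algebra_simps)

lemma remove_pair_eq: "remove_pair c f = remove_coin c (remove_coin (- c) f)"
  by (rule ext) (simp add: remove_pair_def remove_coin_def algebra_simps power2_eq_square)

lemma remove_pair_scale: "remove_pair (b * c) f (b * k) = remove_pair c (\<lambda>j. f (b * j)) k"
  by (simp add: remove_pair_def algebra_simps)

text \<open>Coins in the right pocket are treated as coins of negative value.\<close>

definition pocket_gf :: "int \<Rightarrow> rat fps" where
  "pocket_gf = count_gf (add_coin 1 (add_coin 5 (add_coin 10 (add_coin 25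
     (add_coin (-1) (add_coin (-5) (add_coin (-10) (only_coin (-25)))))))))"

lemma pocket_gf_0: "pocket_gf 0 = Abs_fps (\<lambda>n. of_nat (pocket_count n))"
proof -
  have "pocket_distributions n = add_coin 1 (add_coin 5 (add_coin 10 (add_coin 25
     (add_coin (-1) (add_coin (-5) (add_coin (-10) (only_coin (-25)))))))) n 0" for n
    unfolding pocket_distributions_def add_coin_def only_coin_def by auto
  then show ?thesis by (simp add: pocket_gf_def count_gf_def pocket_count_def)
qed

lemma remove_all_coins:
  "remove_pair 1 (remove_pair 5 (remove_pair 10 (remove_pair 25 pocket_gf))) =
     (\<lambda>k. if k = 0 then 1 else 0)"
proof -
  \<comment> \<open>The coins come off in the order in which \<open>pocket_gf\<close> puts them on;
    commutation then regroups them into pairs.\<close>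
  have "remove_coin (-25) (remove_coin (-10) (remove_coin (-5) (remove_coin (-1)
      (remove_coin 25 (remove_coin 10 (remove_coin 5 (remove_coin 1 pocket_gf))))))) =
     (\<lambda>k. if k = 0 then 1 else 0)"
    unfolding pocket_gf_def
    by (simp add: remove_coin_add_coin finite_add_coin finite_only_coin remove_coin_only_coin)
  then show ?thesis
    unfolding remove_pair_eq by (simp only: remove_coin_commute)
qed

section \<open>Inverting a pair operator\<close>

text \<open>Both neighbours \<open>k - c\<close> and \<open>k + c\<close> carry a factor
  \<open>X\<close>, so the coefficient of \<open>X^n\<close> at \<open>k\<close> is determined by
  lower coefficients at various indices.\<close>

lemma remove_pair_inject:
  assumes "\<And>k. remove_pair c f k = remove_pair c g k"
  shows "f k = g k"
proof -
  have "fps_nth (f k) n = fps_nth (g k) n" for n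
  proof (induction n arbitrary: k rule: less_induct)
    case (less n)
    have rec: "h k = remove_pair c h k + X * (h (k - c) + h (k + c)) - X\<^sup>2 * h k" for h
      by (simp add: remove_pair_def algebra_simps)
    show ?case
      by (subst rec[of f], subst rec[of g])
        (use assms less in \<open>auto simp: fps_X_power_mult_nth\<close>)
  qed
  then show ?thesis by (simp add: fps_ext)
qed

text \<open>By uniqueness a guessed closed form \<open>h\<close> need only be checked, and by
  symmetry only for \<open>m >= 0\<close>, with negative indices reflected. \<open>D\<close> serves
  to clear denominators.\<close>

lemma remove_pair_solve:
  fixes s :: nat
  assumes "\<And>k. remove_pair (int s) f k = g k"
    and "\<And>k. D * g k = g' (nat \<bar>k\<bar>)"
    and "\<And>m. (1 + X\<^sup>2) * h m - X * h (nat \<bar>int m - int s\<bar>) - X * h (m + s) = g' m"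
  shows "D * f k = h (nat \<bar>k\<bar>)"
proof (rule remove_pair_inject[of "int s" "\<lambda>k. D * f k" "\<lambda>k. h (nat \<bar>k\<bar>)"])
  fix k :: int
  have "remove_pair (int s) (\<lambda>k. D * f k) k = D * remove_pair (int s) f k"
    by (simp add: remove_pair_def algebra_simps)
  also have "\<dots> = g' (nat \<bar>k\<bar>)" using assms by simp
  also have "\<dots> = remove_pair (int s) (\<lambda>k. h (nat \<bar>k\<bar>)) k"
  proof (cases "k \<ge> 0")
    case True
    then have "nat \<bar>k\<bar> + s = nat \<bar>k + int s\<bar>" by simp
    with True show ?thesis using assms(3)[of "nat \<bar>k\<bar>"] by (simp add: remove_pair_def)
  next
    case False
    then have "nat \<bar>k\<bar> + s = nat \<bar>k - int s\<bar>" "nat \<bar>int (nat \<bar>k\<bar>) - int s\<bar> = nat \<bar>k + int s\<bar>" by simp_all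
    then show ?thesis using assms(3)[of "nat \<bar>k\<bar>"] by (simp add: remove_pair_def algebra_simps)
  qed
  finally show "remove_pair (int s) (\<lambda>k. D * f k) k = remove_pair (int s) (\<lambda>k. h (nat \<bar>k\<bar>)) k" .
qed

section \<open>Pennies, nickels and dimes\<close>

text \<open>A difference of \<open>k\<close> takes \<open>|k|\<close> pennies in one pocket and any
  number of pairs, one penny in each pocket: X^|k| / (1 - X^2).\<close>

lemma pennies_gf:
  assumes "\<And>k. remove_pair 1 f k = (if k = 0 then 1 else 0)"
  shows "(1 - X\<^sup>2) * f k = X ^ nat \<bar>k\<bar>"
proof (rule remove_pair_solve[where s = 1 and g' = "\<lambda>m. if m = 0 then 1 - X\<^sup>2 else 0"
      and g = "\<lambda>k. if k = 0 then 1 else 0"])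
  fix m :: nat
  show "(1 + X\<^sup>2) * X ^ m - X * X ^ nat \<bar>int m - int 1\<bar> - X * X ^ (m + 1) =
      (if m = 0 then 1 - X\<^sup>2 else 0)"
    by (cases m) (simp_all add: algebra_simps power2_eq_square nat_add_distrib)
qed (use assms in auto)

text \<open>Here \<open>m\<close> counts units of 5 cents. Away from \<open>m = 0\<close> the
  operator of step 1 multiplies \<open>r^m\<close> by 1 + X^2 - X/r - X r. This is 0 for r = X and
  -(1 - X^4)(1 - X^6)/X^4 for r = X^5, whence the last term; the equation at \<open>m = 0\<close>
  fixes the coefficient of \<open>X^m\<close>.\<close>

definition nickel_closed_form :: "nat \<Rightarrow> rat fps" where
  "nickel_closed_form m = (1 + X^2 + X^4 + X^6 + X^8) * X^m - X^4 * (X^m)^5"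

lemma nickels_gf:
  assumes "\<And>k. remove_pair 1 f k = g k" "\<And>k. (1 - X\<^sup>2) * g k = (X ^ nat \<bar>k\<bar>) ^ 5"
  shows "(1 - X^2) * (1 - X^4) * (1 - X^6) * f k = nickel_closed_form (nat \<bar>k\<bar>)"
proof (rule remove_pair_solve[where s = 1 and g = g
      and g' = "\<lambda>m. (1 - X^4) * (1 - X^6) * (X ^ m) ^ 5"])
  fix m :: nat
  show "(1 + X\<^sup>2) * nickel_closed_form m - X * nickel_closed_form (nat \<bar>int m - int 1\<bar>) -
      X * nickel_closed_form (m + 1) = (1 - X^4) * (1 - X^6) * (X ^ m) ^ 5"
  proof (cases m)
    case 0
    have "(1 + X\<^sup>2) * (1 + X^2 + X^4 + X^6 + X^8 - X^4) -
       2 * X * ((1 + X^2 + X^4 + X^6 + X^8) * X - X^4 * X^5) = (1 - X^4) * (1 - X^6)"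
      by algebra
    with 0 show ?thesis by (simp add: nickel_closed_form_def)
  next
    case (Suc i)
    have "(1 + X\<^sup>2) * ((1 + X^2 + X^4 + X^6 + X^8) * (X * y) - X^4 * (X * y)^5) -
       X * ((1 + X^2 + X^4 + X^6 + X^8) * y - X^4 * y^5) -
       X * ((1 + X^2 + X^4 + X^6 + X^8) * (X * (X * y)) - X^4 * (X * (X * y))^5) =
       (1 - X^4) * (1 - X^6) * (X * y) ^ 5" for y
      by algebra
    from this[of "X ^ i"] Suc show ?thesis by (simp add: nickel_closed_form_def nat_add_distrib)
  qed
next
  fix k
  show "(1 - X^2) * (1 - X^4) * (1 - X^6) * g k = (1 - X^4) * (1 - X^6) * (X ^ nat \<bar>k\<bar>) ^ 5"
    by (simp only: assms(2)[of k, symmetric] mult_ac)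
qed (use assms in auto)

text \<open>Step 2 multiplies \<open>X^m\<close> by -(1 - X)(1 - X^3)/X and \<open>(X^m)^5\<close>
  by -(1 - X^9)(1 - X^11)/X^9. Dividing \<open>nickel_closed_form\<close>, scaled by (1 - X^9)(1 -
  X^11), termwise by these gives \<open>dime_power\<close> and the \<open>X^13\<close>
  below.\<close>

definition dime_power :: "rat fps" where
  "dime_power = - X * (1 + X^2 + X^4 + X^6 + X^8) * (1 + X^3 + X^6) *
     (1 + X + X^2 + X^3 + X^4 + X^5 + X^6 + X^7 + X^8 + X^9 + X^10)"

definition dime_even :: "rat fps" where
  "dime_even = (1 + X) * (1 + X^2) * (1 + X^3) * (1 + X^2 + X^4 + X^6 + X^8) *
     (1 + X^2 + X^5 + 2 * X^6 + X^7 + X^10 + X^12)"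

definition dime_odd :: "rat fps" where
  "dime_odd = X * (1 + X)^2 * (1 + X^2) * (1 + X^3) * (1 + X^4) * (1 + X^6) *
     (1 + X^2 + X^4 + X^6 + X^8)"

text \<open>On each parity class, step 2 kills the multiples of \<open>X^(m div 2)\<close>; the
  equations at \<open>m = 0\<close> and \<open>m = 1\<close> fix the factors
  \<open>dime_even\<close> and \<open>dime_odd\<close>.\<close>

definition dime_closed_form :: "nat \<Rightarrow> rat fps" where
  "dime_closed_form m = dime_power * X^m + X^13 * (X^m)^5 +
     (if even m then dime_even else dime_odd) * X^(m div 2)"

lemma dimes_gf:
  assumes "\<And>k. remove_pair 2 f k = g k"
    and "\<And>k. (1 - X^2) * (1 - X^4) * (1 - X^6) * g k = nickel_closed_form (nat \<bar>k\<bar>)"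
  shows "(1 - X^2) * (1 - X^4) * (1 - X^6) * (1 - X^9) * (1 - X^11) * f k =
     dime_closed_form (nat \<bar>k\<bar>)"
proof (rule remove_pair_solve[where s = 2 and g = g
      and g' = "\<lambda>m. (1 - X^9) * (1 - X^11) * nickel_closed_form m"])
  fix m :: nat
  \<comment> \<open>With \<open>y = X^i\<close>, \<open>c y\<close> and \<open>d y\<close> are the
    values at \<open>2 * i\<close> and \<open>2 * i + 1\<close>, which turns each case into a
    polynomial identity.\<close>
  define c where "c y = dime_power * y^2 + X^13 * (y^2)^5 + dime_even * y" for y
  define d where "d y = dime_power * (X * y^2) + X^13 * (X * y^2)^5 + dime_odd * y" for y
  have even: "dime_closed_form (2 * i) = c (X ^ i)" for i
    by (simp add: dime_closed_form_def c_def power_mult[symmetric] mult.commute)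
  have odd: "dime_closed_form (Suc (2 * i)) = d (X ^ i)" for i
    by (simp add: dime_closed_form_def d_def power_mult[symmetric] mult.commute)
  \<comment> \<open>At \<open>m = 0\<close> and \<open>m = 1\<close> the index \<open>m - 2\<close>
    is reflected, to 2 and to 1.\<close>
  consider "m = 0" | "m = 1" | i where "m = 2 * (i + 1)" | i where "m = Suc (2 * (i + 1))"
    by (metis Suc_eq_plus1 evenE mult_0_right not0_implies_Suc oddE One_nat_def)
  then show "(1 + X\<^sup>2) * dime_closed_form m - X * dime_closed_form (nat \<bar>int m - int 2\<bar>) -
      X * dime_closed_form (m + 2) = (1 - X^9) * (1 - X^11) * nickel_closed_form m"
  proof cases
    case 1
    have "(1 + X\<^sup>2) * (dime_power + X^13 + dime_even) - 2 * (X * c X) =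
        (1 - X^9) * (1 - X^11) * (1 + X^2 + X^4 + X^6 + X^8 - X^4)"
      unfolding c_def dime_power_def dime_even_def by algebra
    with 1 even[of 0] even[of 1] show ?thesis
      by (simp add: nickel_closed_form_def c_def numeral_2_eq_2)
  next
    case 2
    have "(1 + X\<^sup>2 - X) * (dime_power * X + X^13 * X^5 + dime_odd) - X * d X =
        (1 - X^9) * (1 - X^11) * ((1 + X^2 + X^4 + X^6 + X^8) * X - X^4 * X^5)"
      unfolding d_def dime_power_def dime_odd_def by algebra
    with 2 odd[of 0] odd[of 1] show ?thesis
      by (simp add: nickel_closed_form_def d_def numeral_3_eq_3 algebra_simps)
  next
    case (3 i)
    have "(1 + X\<^sup>2) * c (X * y) - X * c y - X * c (X * (X * y)) =
        (1 - X^9) * (1 - X^11) * ((1 + X^2 + X^4 + X^6 + X^8) * (X * y)^2 - X^4 * ((X * y)^2)^5)" for y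
      unfolding c_def dime_power_def dime_even_def by algebra
    moreover have "dime_closed_form m = c (X * X^i)" "dime_closed_form (m + 2) = c (X * (X * X^i))"
      "dime_closed_form (nat \<bar>int m - int 2\<bar>) = c (X^i)"
      using even[of "i + 1"] even[of "i + 2"] even[of i] 3 by (simp_all add: nat_add_distrib nat_mult_distrib)
    moreover have "nickel_closed_form m =
        (1 + X^2 + X^4 + X^6 + X^8) * (X * X^i)^2 - X^4 * ((X * X^i)^2)^5"
      by (simp add: 3 nickel_closed_form_def power_mult[symmetric] power_add[symmetric] mult.commute
          flip: power_Suc)
    ultimately show ?thesis by simp
  next
    case (4 i)
    have "(1 + X\<^sup>2) * d (X * y) - X * d y - X * d (X * (X * y)) =
        (1 - X^9) * (1 - X^11) * ((1 + X^2 + X^4 + X^6 + X^8) * (X * (X * y)^2) - X^4 * (X * (X * y)^2)^5)" for y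
      unfolding d_def dime_power_def dime_odd_def by algebra
    moreover have "dime_closed_form m = d (X * X^i)" "dime_closed_form (m + 2) = d (X * (X * X^i))"
      "dime_closed_form (nat \<bar>int m - int 2\<bar>) = d (X^i)"
      using odd[of "i + 1"] odd[of "i + 2"] odd[of i] 4 by (simp_all add: nat_add_distrib nat_mult_distrib)
    moreover have "nickel_closed_form m =
        (1 + X^2 + X^4 + X^6 + X^8) * (X * (X * X^i)^2) - X^4 * (X * (X * X^i)^2)^5"
      by (simp add: 4 nickel_closed_form_def power_mult[symmetric] power_add[symmetric] mult.commute
          flip: power_Suc)
    ultimately show ?thesis by simp
  qed
next
  fix k
  show "(1 - X^2) * (1 - X^4) * (1 - X^6) * (1 - X^9) * (1 - X^11) * g k =
      (1 - X^9) * (1 - X^11) * nickel_closed_form (nat \<bar>k\<bar>)"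
    by (simp only: assms(2)[of k, symmetric] mult_ac)
qed (use assms in auto)


section \<open>Quarters and the rational generating function\<close>

lemma geometric_solve:
  fixes u h :: "nat \<Rightarrow> rat fps"
  assumes "\<And>j. u j = g j + X * u (Suc j)" and "\<And>j. h j = g j + X * h (Suc j)"
  shows "u j = h j"
proof -
  have "fps_nth (u j) n = fps_nth (h j) n" for n
  proof (induction n arbitrary: j)
    case 0
    show ?case by (subst assms(1), subst assms(2)) simp
  next
    case (Suc n)
    then show ?case by (subst assms(1), subst assms(2)) simp
  qed
  then show ?thesis by (simp add: fps_ext)
qed

lemma remove_pair_even:
  assumes "\<And>k. remove_pair c f k = g k" "\<And>k. g (- k) = g k"
  shows "f (- k) = f k"
proof (rule remove_pair_inject[of c "\<lambda>k. f (- k)" f])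
  fix k
  have "- k - c = - (k + c)" "- k + c = - (k - c)" by simp_all
  then have "remove_pair c (\<lambda>k. f (- k)) k = remove_pair c f (- k)"
    by (simp only: remove_pair_def) (simp add: algebra_simps)
  then show "remove_pair c (\<lambda>k. f (- k)) k = remove_pair c f k"
    by (simp add: assms)
qed

text \<open>
  For the last pair of coins only the coefficient at \<open>0\<close> is needed; it is obtained by adding the
  two coins one after the other, the first addition being the one-sided sum
  \<open>v j = g j + X * g (j + 1) + X^2 * g (j + 2) + \<dots>\<close>.
\<close>

lemma remove_pair_at_0:
  fixes h :: "nat \<Rightarrow> rat fps"
  assumes f: "\<And>k. remove_pair 1 f k = g k" and even: "\<And>k. g (- k) = g k"
    and h: "\<And>j. h j = D * g (int j) + X * h (Suc j)"
  shows "(1 - X^2) * D * f 0 = D * g 0 + 2 * X * h 1"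
proof -
  \<comment> \<open>Up to \<open>D\<close>, \<open>v\<close> is \<open>f\<close> with the coin of
    value 1 removed; removing the coin of value -1 as well leads to \<open>g\<close>, which is the
    recursion below.\<close>
  define v where "v j = D * (f (int j) - X * f (int j - 1))" for j
  have "v j = D * g (int j) + X * v (Suc j)" for j
    by (simp add: v_def f[of "int j", symmetric] remove_pair_def algebra_simps power2_eq_square)
  then have v: "v j = h j" for j
    using h by (rule geometric_solve[of v "\<lambda>j. D * g (int j)" h])
  have "f (- 1) = f 1" by (rule remove_pair_even[OF f even])
  then have "(1 - X^2) * D * f 0 = v 0 + X * v 1"
    by (simp add: v_def algebra_simps power2_eq_square)
  also have "\<dots> = D * g 0 + 2 * X * h 1"
    using h[of 0] by (simp add: v algebra_simps)
  finally show ?thesis .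
qed

text \<open>The sum of \<open>X^i * dime_closed_form (5 * (j + i))\<close> over all
  \<open>i\<close>, times (1 - X^6)(1 - X^26)(1 - X^7). A quarter is five units, so the ratios are X
  * X^5 and X * X^25, and X^2 * X^5 over two steps for the half powers; \<open>X^3\<close> and
  \<open>X^4\<close> are the shifts inside such a double step.\<close>

definition quarter_sum :: "nat \<Rightarrow> rat fps" where
  "quarter_sum j =
     (1 - X^26) * (1 - X^7) * dime_power * X^(5 * j) +
     (1 - X^6) * (1 - X^7) * X^13 * (X^(5 * j))^5 +
     (1 - X^6) * (1 - X^26) *
       (if even j then dime_even + dime_odd * X^3 else dime_odd + dime_even * X^4) * X^(5 * j div 2)"

lemma quarter_sum_rec:
  "quarter_sum j =
     (1 - X^6) * (1 - X^26) * (1 - X^7) * dime_closed_form (5 * j) + X * quarter_sum (Suc j)"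
proof -
  define c where "c x p q r e z =
     (1 - X^26) * (1 - X^7) * p * x + (1 - X^6) * (1 - X^7) * q * x^5 +
     (1 - X^6) * (1 - X^26) * (r + e) * z" for x p q r e z
  show ?thesis
  proof (cases "even j")
    case True
    then obtain i where j: "j = 2 * i" by blast
    have "5 * j = 2 * (5 * i)" "5 * Suc j = Suc (2 * (5 * i + 2))" using j by simp_all
    then have div: "5 * j div 2 = 5 * i" "5 * Suc j div 2 = 5 * i + 2"
      by (simp_all only: nonzero_mult_div_cancel_left) simp_all
    have pow: "X^(5 * j) = x * x" "X^(5 * Suc j) = X^5 * x * x" "X^(5 * i + 2) = X^2 * x"
      if "x = X^(5 * i)" for x
      using j that by (simp_all add: power_add[symmetric] mult_2[symmetric] power_mult[symmetric] algebra_simps)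
    have "(1 - X^26) * (1 - X^7) * p * (x * x) + (1 - X^6) * (1 - X^7) * X^13 * (x * x)^5 +
        (1 - X^6) * (1 - X^26) * (e + o' * X^3) * x =
      (1 - X^6) * (1 - X^26) * (1 - X^7) * (p * (x * x) + X^13 * (x * x)^5 + e * x) +
      X * ((1 - X^26) * (1 - X^7) * p * (X^5 * x * x) + (1 - X^6) * (1 - X^7) * X^13 * (X^5 * x * x)^5 +
        (1 - X^6) * (1 - X^26) * (o' + e * X^4) * (X^2 * x))" for x p e o'
      by algebra
    from this[of dime_power "X^(5 * i)" dime_even dime_odd] show ?thesis
      using True by (simp only: quarter_sum_def dime_closed_form_def div pow[OF refl]) simp
  next
    case False
    then obtain i where j: "j = Suc (2 * i)" by (metis oddE Suc_eq_plus1)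
    have "5 * j = Suc (2 * (5 * i + 2))" "5 * Suc j = 2 * (5 * i + 5)" using j by simp_all
    then have div: "5 * j div 2 = 5 * i + 2" "5 * Suc j div 2 = 5 * i + 5"
      by (simp_all only: nonzero_mult_div_cancel_left) simp_all
    have pow: "X^(5 * j) = X^5 * x * x" "X^(5 * Suc j) = X^10 * x * x" "X^(5 * i + 2) = X^2 * x"
      "X^(5 * i + 5) = X^5 * x"
      if "x = X^(5 * i)" for x
      using j that by (simp_all add: power_add[symmetric] mult_2[symmetric] power_mult[symmetric] algebra_simps)
    have "(1 - X^26) * (1 - X^7) * p * (X^5 * x * x) + (1 - X^6) * (1 - X^7) * X^13 * (X^5 * x * x)^5 +
        (1 - X^6) * (1 - X^26) * (o' + e * X^4) * (X^2 * x) =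
      (1 - X^6) * (1 - X^26) * (1 - X^7) * (p * (X^5 * x * x) + X^13 * (X^5 * x * x)^5 + o' * (X^2 * x)) +
      X * ((1 - X^26) * (1 - X^7) * p * (X^10 * x * x) + (1 - X^6) * (1 - X^7) * X^13 * (X^10 * x * x)^5 +
        (1 - X^6) * (1 - X^26) * (e + o' * X^3) * (X^5 * x))" for x p e o'
      by algebra
    from this[of dime_power "X^(5 * i)" dime_odd dime_even] show ?thesis
      using False by (simp only: quarter_sum_def dime_closed_form_def div pow[OF refl]) simp
  qed
qed

text \<open>The fraction obtained is not in lowest terms: the factor
  \<open>(1 - X) * (1 - X^4) * (1 + X^3 + X^6)\<close> also splits off its denominator.\<close>

lemma pocket_numerator_closed_form:
  "(1 - X^6) * (1 - X^26) * (1 - X^7) * dime_closed_form 0 + 2 * X * quarter_sum 1 =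
     pocket_numerator X * ((1 - X) * (1 - X^4) * (1 + X^3 + X^6))"
proof -
  have "(1 - X^6) * (1 - X^26) * (1 - X^7) * (dime_power + X^13 + dime_even) +
      2 * X * ((1 - X^26) * (1 - X^7) * dime_power * X^5 + (1 - X^6) * (1 - X^7) * X^13 * (X^5)^5 +
        (1 - X^6) * (1 - X^26) * (dime_odd + dime_even * X^4) * X^2) =
     pocket_numerator X * ((1 - X) * (1 - X^4) * (1 + X^3 + X^6))"
    unfolding dime_power_def dime_even_def dime_odd_def pocket_numerator_def by algebra
  then show ?thesis by (simp add: dime_closed_form_def quarter_sum_def)
qed

lemma pocket_denominator_closed_form:
  "(1 - X^2) * ((1 - X^6) * (1 - X^26) * (1 - X^7) *
     ((1 - X^2) * (1 - X^4) * (1 - X^6) * (1 - X^9) * (1 - X^11))) =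
   pocket_denominator X * ((1 - X) * (1 - X^4) * (1 + X^3 + X^6))"
  unfolding pocket_denominator_def by algebra

lemma pocket_gf_denominator:
  "Abs_fps (\<lambda>n. of_nat (pocket_count n)) * pocket_denominator X = pocket_numerator X"
proof -
  \<comment> \<open>\<open>f1\<close> is indexed in cents, \<open>f2\<close> and \<open>f3\<close>
    in units of 5 cents, \<open>f4\<close> in units of 25 cents. Dimes thus become a step of 2, and
    quarters a step of 1 with \<open>f3\<close> sampled at multiples of 5.\<close>
  define f1 where "f1 = remove_pair 5 (remove_pair 10 (remove_pair 25 pocket_gf))"
  define f2 where "f2 j = remove_pair 10 (remove_pair 25 pocket_gf) (5 * j)" for j
  define f3 where "f3 j = remove_pair 25 pocket_gf (5 * j)" for j
  define f4 where "f4 j = pocket_gf (25 * j)" for j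
  let ?D2 = "(1 - X^2) * (1 - X^4) * (1 - X^6)"
  let ?D3 = "?D2 * (1 - X^9) * (1 - X^11)"
  let ?D4 = "(1 - X^6) * (1 - X^26) * (1 - X^7) * ?D3"
  let ?C = "(1 - X) * (1 - X^4) * (1 + X^3 + X^6)"
  have f1: "(1 - X^2) * f1 k = X ^ nat \<bar>k\<bar>" for k
    by (rule pennies_gf) (simp add: f1_def remove_all_coins)
  have "remove_pair 1 f2 j = f1 (5 * j)" for j
    using remove_pair_scale[of 5 1 "remove_pair 10 (remove_pair 25 pocket_gf)" j]
    by (simp add: f1_def f2_def[abs_def])
  moreover have "(1 - X^2) * f1 (5 * j) = (X ^ nat \<bar>j\<bar>) ^ 5" for j
    by (simp add: f1 abs_mult nat_mult_distrib power_mult[symmetric] mult.commute)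
  ultimately have f2: "?D2 * f2 j = nickel_closed_form (nat \<bar>j\<bar>)" for j
    by (rule nickels_gf)
  have "remove_pair 2 f3 j = f2 j" for j
    using remove_pair_scale[of 5 2 "remove_pair 25 pocket_gf" j]
    by (simp add: f2_def f3_def[abs_def])
  from this f2 have f3: "?D3 * f3 j = dime_closed_form (nat \<bar>j\<bar>)" for j
    by (rule dimes_gf)
  have "fps_nth ?D3 0 \<noteq> 0" by simp
  then have nz: "?D3 \<noteq> 0" by (metis fps_zero_nth)
  have f4: "remove_pair 1 f4 j = f3 (5 * j)" for j
    using remove_pair_scale[of 25 1 pocket_gf j] by (simp add: f3_def f4_def[abs_def])
  have even: "f3 (5 * - j) = f3 (5 * j)" for j
  proof -
    have "?D3 * f3 (5 * - j) = ?D3 * f3 (5 * j)" by (simp only: f3) simp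
    then show ?thesis by (rule mult_left_cancel[OF nz, THEN iffD1])
  qed
  have D4: "?D4 * f3 (5 * int j) = (1 - X^6) * (1 - X^26) * (1 - X^7) * dime_closed_form (5 * j)" for j
    using f3[of "5 * int j"] by (simp add: nat_mult_distrib mult.assoc)
  have "quarter_sum j = ?D4 * f3 (5 * int j) + X * quarter_sum (Suc j)" for j
    unfolding D4 by (rule quarter_sum_rec)
  from remove_pair_at_0[where g = "\<lambda>j. f3 (5 * j)", OF f4 even this]
  have "(1 - X^2) * ?D4 * f4 0 = ?D4 * f3 0 + 2 * X * quarter_sum 1" by simp
  also have "\<dots> = pocket_numerator X * ?C"
    using D4[of 0] by (simp only: of_nat_0 mult_zero_right pocket_numerator_closed_form)
  finally have "?C * (f4 0 * pocket_denominator X) = ?C * pocket_numerator X"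
    unfolding pocket_denominator_closed_form by (simp only: mult_ac)
  moreover have "?C \<noteq> 0"
  proof -
    have "fps_nth ?C 0 \<noteq> 0" by simp
    then show ?thesis by (metis fps_zero_nth)
  qed
  ultimately have "f4 0 * pocket_denominator X = pocket_numerator X" by (simp only: mult_cancel_left simp_thms)
  then show ?thesis by (simp add: f4_def pocket_gf_0)
qed


section \<open>Partial fractions and explicit coefficients\<close>

lemma horner_sum_fps_nth: "fps_nth (horner_sum of_int X as) n = (if n < length as then of_int (as ! n) else 0)"
proof (induction as arbitrary: n)
  case (Cons a as)
  then show ?case by (cases n) (simp_all add: fps_of_int[symmetric])
qed simp

text \<open>For nonempty \<open>as\<close> of length d, the expansion of the polynomial with
  coefficients \<open>as\<close> over (1 - X^d)^(k + 1).\<close>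

definition periodic_binomial_fps :: "nat \<Rightarrow> int list \<Rightarrow> rat fps" where
  "periodic_binomial_fps k as =
     Abs_fps (\<lambda>n. of_int (as ! (n mod length as) * int ((n div length as + k) choose k)))"

lemma periodic_binomial_fps_0:
  assumes "as \<noteq> []"
  shows "(1 - X ^ length as) * periodic_binomial_fps 0 as = horner_sum of_int X as"
proof (rule fps_ext)
  fix n
  show "fps_nth ((1 - X ^ length as) * periodic_binomial_fps 0 as) n = fps_nth (horner_sum of_int X as) n"
    using assms
    by (auto simp: horner_sum_fps_nth periodic_binomial_fps_def left_diff_distrib fps_X_power_mult_nth
        not_less le_mod_geq)
qed

lemma periodic_binomial_fps_Suc:
  assumes "as \<noteq> []"
  shows "(1 - X ^ length as) * periodic_binomial_fps (Suc k) as = periodic_binomial_fps k as"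
proof (rule fps_ext)
  fix n
  show "fps_nth ((1 - X ^ length as) * periodic_binomial_fps (Suc k) as) n =
      fps_nth (periodic_binomial_fps k as) n"
  proof (cases "n < length as")
    case True
    then show ?thesis
      by (simp add: periodic_binomial_fps_def left_diff_distrib fps_X_power_mult_nth)
  next
    case False
    then have "n mod length as = (n - length as) mod length as"
      "n div length as = Suc ((n - length as) div length as)"
      using assms by (simp_all add: le_mod_geq le_div_geq)
    with False show ?thesis
      by (simp add: periodic_binomial_fps_def fps_X_power_mult_nth algebra_simps)
  qed
qed

lemma periodic_binomial_fps:
  assumes "as \<noteq> []"
  shows "(1 - X ^ length as) ^ Suc k * periodic_binomial_fps k as = horner_sum of_int X as"
proof (induction k)
  case 0
  then show ?case using periodic_binomial_fps_0[OF assms] by simp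
next
  case (Suc k)
  have "(1 - X ^ length as) ^ Suc (Suc k) * periodic_binomial_fps (Suc k) as =
     (1 - X ^ length as) ^ Suc k * ((1 - X ^ length as) * periodic_binomial_fps (Suc k) as)"
    by (simp only: power_Suc mult_ac)
  with Suc show ?case by (simp only: periodic_binomial_fps_Suc[OF assms])
qed

text \<open>The shift lowers the quotient by \<open>i\<close>. Below the shift the upper index is
  less than \<open>k\<close>, so the binomial vanishes as it should.\<close>

lemma shifted_periodic_binomial_fps_nth:
  assumes "as \<noteq> []" "i \<le> k"
  shows "fps_nth (X ^ (length as * i) * periodic_binomial_fps k as) n =
     of_int (as ! (n mod length as) * int ((n div length as + k - i) choose k))"
proof (cases "n < length as * i")
  case True
  then have "n div length as + k - i < k"
    using assms(2) by (simp add: div_less_iff_less_mult assms(1) mult.commute less_diff_conv2)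
  with True show ?thesis by (simp add: fps_X_power_mult_nth)
next
  case False
  then obtain m where n: "n = length as * i + m" by (metis le_Suc_ex not_less)
  with assms show ?thesis by (simp add: fps_X_power_mult_nth periodic_binomial_fps_def)
qed

text \<open>Partial fraction numerators, made integral by the factor 7007 = 7^2 * 11 * 13. Entry
  \<open>r\<close> of row \<open>i\<close> belongs to t^(6 i + r) over (1 - t^6)^7. As polynomials,
  the next three lists vanish at 1, and \<open>coeffs_26\<close> also at -1, so all poles there stay
  in the first fraction.\<close>

definition sextic_coeffs :: "int list list" where
  "sextic_coeffs =
     [[16375, -7082, 30186, 14142, 79186, 92388],
      [110931, 346474, 364373, 675306, 757654, 1118560],
      [1515425, 1391980, 1944259, 1766256, 2194985, 1928110],
      [1715695, 2140056, 1459579, 1765780, 1036135, 1260436],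
      [1045228, 451026, 655181, 122194, 398505, -49488],
      [-16672, 88902, -66750, 67678, -79483, 60804],
      [13694, -10680, 13848, -10680, 13694, -10134]]"

definition coeffs_26 :: "int list" where
  "coeffs_26 = [-5390, 3234, 0, -2156, 3234, -3234, 6468, -7546, 9702, -6468, 9702, -7546, 6468, -3234, 3234, -2156, 0, 3234, -5390, 6468, -8624, 6468, -10780, 6468, -8624, 6468]"

definition coeffs_11 :: "int list" where
  "coeffs_11 = [-2548, 1274, 1274, -2548, 5096, -7644, 7644, -7644, 7644, -7644, 5096]"

definition coeffs_7 :: "int list" where
  "coeffs_7 = [-1430, 2574, -3432, 4576, -3432, 2574, -1430]"

text \<open>The four fractions over their common denominator; the last factor on the right is the
  one by which \<open>pocket_denominator\<close> must be expanded to reach it.\<close>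

lemma partial_fractions_numerator:
  fixes t :: "'a::idom"
  shows "(\<Sum>i<7. t^(6 * i) * horner_sum of_int t (sextic_coeffs ! i)) * ((1 - t^26) * (1 - t^11) * (1 - t^7)) +
   (1 - t^6)^7 * (horner_sum of_int t coeffs_26 * ((1 - t^11) * (1 - t^7)) +
     horner_sum of_int t coeffs_11 * ((1 - t^26) * (1 - t^7)) + horner_sum of_int t coeffs_7 * ((1 - t^26) * (1 - t^11))) =
   7007 * (pocket_numerator t * ((1 - t)^3 * (1 + t)^3 * (t^2 + t + 1)^4 * (t^2 - t + 1)^5))"
  unfolding sextic_coeffs_def coeffs_26_def coeffs_11_def coeffs_7_def pocket_numerator_def
  by (simp add: lessThan_nat_numeral lessThan_Suc del: power_Suc) algebra

lemma partial_fractions_denominator: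
  "pocket_denominator X * ((1 - X)^3 * (1 + X)^3 * (X^2 + X + 1)^4 * (X^2 - X + 1)^5) =
     (1 - X^6)^7 * ((1 - X^26) * (1 - X^11) * (1 - X^7))"
  unfolding pocket_denominator_def by algebra


lemma pocket_count_binomial:
  "7007 * int (pocket_count n) =
     (\<Sum>i<7. sextic_coeffs ! i ! (n mod 6) * int ((n div 6 + 6 - i) choose 6)) +
     coeffs_26 ! (n mod 26) + coeffs_11 ! (n mod 11) + coeffs_7 ! (n mod 7)"
proof -
  let ?D = "(1 - X^6)^7 * ((1 - X^26) * (1 - X^11) * (1 - X^7))"
  let ?E = "(1 - X)^3 * (1 + X)^3 * (X^2 + X + 1)^4 * (X^2 - X + 1)^5"
  let ?F = "Abs_fps (\<lambda>n. of_nat (pocket_count n)) :: rat fps"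
  define S where "S = (\<Sum>i<7. X^(6 * i) * periodic_binomial_fps 6 (sextic_coeffs ! i))"
  define R where "R = S + periodic_binomial_fps 0 coeffs_26 + periodic_binomial_fps 0 coeffs_11 +
    periodic_binomial_fps 0 coeffs_7"
  have len: "length (sextic_coeffs ! i) = 6" if "i < 7" for i
  proof -
    have "\<forall>as \<in> set sextic_coeffs. length as = 6" "length sextic_coeffs = 7"
      by (simp_all add: sextic_coeffs_def)
    with that show ?thesis by simp
  qed
  have len': "length coeffs_26 = 26" "length coeffs_11 = 11" "length coeffs_7 = 7"
    by (simp_all add: coeffs_26_def coeffs_11_def coeffs_7_def)
  have ne: "sextic_coeffs ! i \<noteq> []" if "i < 7" for i
    using len[OF that] by auto
  have ne': "coeffs_26 \<noteq> []" "coeffs_11 \<noteq> []" "coeffs_7 \<noteq> []"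
    by (simp_all add: coeffs_26_def coeffs_11_def coeffs_7_def)
  have "(1 - X^6)^7 * (X^(6 * i) * periodic_binomial_fps 6 (sextic_coeffs ! i)) =
      X^(6 * i) * horner_sum of_int X (sextic_coeffs ! i)" if "i < 7" for i
    using periodic_binomial_fps[OF ne[OF that], of 6] len[OF that]
    by (simp add: mult.left_commute del: power_Suc)
  then have S: "(1 - X^6)^7 * S = (\<Sum>i<7. X^(6 * i) * horner_sum of_int X (sextic_coeffs ! i))"
    unfolding S_def sum_distrib_left by (intro sum.cong refl) (simp only: lessThan_iff)
  have P: "(1 - X^26) * periodic_binomial_fps 0 coeffs_26 = horner_sum of_int X coeffs_26"
    "(1 - X^11) * periodic_binomial_fps 0 coeffs_11 = horner_sum of_int X coeffs_11"
    "(1 - X^7) * periodic_binomial_fps 0 coeffs_7 = horner_sum of_int X coeffs_7"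
    using ne'[THEN periodic_binomial_fps_0] by (simp_all only: len')
  have distrib: "a * (b * c * d) * (s + u + v + w) = (a * s) * (b * c * d) +
      a * ((b * u) * (c * d) + (c * v) * (b * d) + (d * w) * (b * c))"
    for a b c d s u v w :: "rat fps"
    by algebra
  have "?D * R = 7007 * (pocket_numerator X * ?E)"
    unfolding R_def distrib S P by (rule partial_fractions_numerator)
  also have "\<dots> = 7007 * (?F * (pocket_denominator X * ?E))"
    by (simp only: pocket_gf_denominator[symmetric] mult.assoc)
  also have "\<dots> = ?D * (7007 * ?F)"
    unfolding partial_fractions_denominator by (simp only: mult_ac)
  finally have "?D * R = ?D * (7007 * ?F)" .
  moreover have "?D \<noteq> 0"
  proof -
    have "fps_nth ?D 0 \<noteq> 0" by simp
    then show ?thesis by (metis fps_zero_nth)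
  qed
  ultimately have "R = 7007 * ?F" by (simp only: mult_cancel_left simp_thms)
  then have "fps_nth R n = 7007 * of_nat (pocket_count n)"
    by (simp add: numeral_fps_const)
  moreover have "fps_nth S n =
      of_int (\<Sum>i<7. sextic_coeffs ! i ! (n mod 6) * int ((n div 6 + 6 - i) choose 6))"
    unfolding S_def fps_sum_nth of_int_sum
  proof (rule sum.cong[OF refl])
    fix i :: nat
    assume "i \<in> {..<7}"
    then have i: "i < 7" "i \<le> 6" by auto
    show "fps_nth (X^(6 * i) * periodic_binomial_fps 6 (sextic_coeffs ! i)) n =
        of_int (sextic_coeffs ! i ! (n mod 6) * int ((n div 6 + 6 - i) choose 6))"
      using shifted_periodic_binomial_fps_nth[OF ne[OF i(1)] i(2), of n] by (simp only: len[OF i(1)])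
  qed
  ultimately have "of_int (7007 * int (pocket_count n)) = (of_int
     ((\<Sum>i<7. sextic_coeffs ! i ! (n mod 6) * int ((n div 6 + 6 - i) choose 6)) +
     coeffs_26 ! (n mod 26) + coeffs_11 ! (n mod 11) + coeffs_7 ! (n mod 7)) :: rat)"
    by (simp add: R_def periodic_binomial_fps_def len')
  then show ?thesis by (simp only: of_int_eq_iff)
qed

section \<open>Falling factorials and quasi-polynomiality\<close>

text \<open>Generic in the ring because integers, rationals and polynomials are all
  substituted.\<close>

definition falling6 :: "'a::comm_ring_1 \<Rightarrow> 'a" where
  "falling6 x = x * (x - 1) * (x - 2) * (x - 3) * (x - 4) * (x - 5)"

lemma falling6_binomial: "falling6 (int m) = 720 * int (m choose 6)"
proof -
  have "720 * of_nat (m choose 6) = (falling6 (of_nat m) :: rat)"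
    using gbinomial_mult_fact[of 6 "of_nat m :: rat"]
    by (simp add: falling6_def fact_numeral binomial_gbinomial atLeast0LessThan
        lessThan_nat_numeral lessThan_Suc mult_ac)
  then have "(of_int (720 * int (m choose 6)) :: rat) = of_int (falling6 (int m))"
    by (simp add: falling6_def)
  then show ?thesis by (simp only: of_int_eq_iff)
qed

text \<open>Clearing 6! too (5045040 = 720 * 7007) leaves polynomials in
  \<open>n div 6\<close>.\<close>

lemma pocket_count_falling6:
  "5045040 * int (pocket_count n) =
     (\<Sum>i<7. sextic_coeffs ! i ! (n mod 6) * falling6 (int (n div 6) + 6 - int i)) +
     720 * (coeffs_26 ! (n mod 26) + coeffs_11 ! (n mod 11) + coeffs_7 ! (n mod 7))"
proof -
  have "falling6 (int (n div 6) + 6 - int i) = 720 * int ((n div 6 + 6 - i) choose 6)" if "i < 7" for i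
    using that falling6_binomial[of "n div 6 + 6 - i"] by simp
  then have "(\<Sum>i<7. sextic_coeffs ! i ! (n mod 6) * falling6 (int (n div 6) + 6 - int i)) =
     720 * (\<Sum>i<7. sextic_coeffs ! i ! (n mod 6) * int ((n div 6 + 6 - i) choose 6))"
    by (simp add: sum_distrib_left mult_ac)
  with pocket_count_binomial[of n] show ?thesis by simp
qed

lemma quasi_polynomial_pocket_count: "quasi_polynomial (\<lambda>n. of_nat (pocket_count n))"
proof -
  \<comment> \<open>On a residue class \<open>n div 6\<close> is (n - n mod 6) / 6, which gives the
    linear polynomial inside \<open>falling6\<close>. The period 6006 used below is the lcm of 6,
    26, 11 and 7.\<close>
  define f :: "nat \<Rightarrow> rat poly" where
    "f i = smult (1 / 5045040)
       ((\<Sum>k<7. smult (of_int (sextic_coeffs ! k ! (i mod 6)))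
          (falling6 [: 6 - of_nat k - of_nat (i mod 6) / 6, 1 / 6 :])) +
        [: of_int (720 * (coeffs_26 ! (i mod 26) + coeffs_11 ! (i mod 11) + coeffs_7 ! (i mod 7))) :])"
    for i
  have "of_nat (pocket_count n) = poly (f (n mod 6006)) (of_nat n)" for n
  proof -
    have mod: "n mod 6006 mod 6 = n mod 6" "n mod 6006 mod 26 = n mod 26"
      "n mod 6006 mod 11 = n mod 11" "n mod 6006 mod 7 = n mod 7"
      by (simp_all add: mod_mod_cancel)
    have "of_nat n = (of_nat (6 * (n div 6) + n mod 6) :: rat)" by simp
    then have div: "of_nat (n div 6) + 6 - of_nat k =
        6 - of_nat k - of_nat (n mod 6) / 6 + of_nat n * (1 / 6 :: rat)" for k
      by (simp only: of_nat_add of_nat_mult) (simp add: field_simps)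
    have falling6_hom: "of_int (falling6 (int (n div 6) + 6 - int k)) =
        (falling6 (of_nat (n div 6) + 6 - of_nat k) :: rat)" for k
      by (simp add: falling6_def)
    have falling6_poly: "poly (falling6 p) x = falling6 (poly p x)" for p and x :: rat
      by (simp add: falling6_def)
    have "5045040 * of_nat (pocket_count n) = (of_int (5045040 * int (pocket_count n)) :: rat)"
      by simp
    also have "\<dots> = 5045040 * poly (f (n mod 6006)) (of_nat n)"
      unfolding pocket_count_falling6 f_def mod
      by (simp add: poly_sum falling6_poly falling6_hom div)
    finally show ?thesis by simp
  qed
  then show ?thesis
    unfolding quasi_polynomial_def by (intro exI[of _ 6006] conjI exI[of _ f]) auto
qed

section \<open>Asymptotics\<close>

text \<open>After expansion every term but the leading power contains a bounded factor.\<close>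

lemma prod_plus_bounded_bigo:
  fixes u :: "nat \<Rightarrow> nat \<Rightarrow> real"
  assumes "\<And>l. u l \<in> O(\<lambda>_. 1)"
  shows "(\<lambda>n. (\<Prod>l<Suc m. real n + u l n) - real n ^ Suc m) \<in> O(\<lambda>n. real n ^ m)"
proof (induction m)
  case 0
  then show ?case using assms[of 0] by simp
next
  case (Suc m)
  have "(\<lambda>_. 1) \<in> O(\<lambda>n. real n)" by (intro bigoI[of _ 1] eventually_mono[OF eventually_ge_at_top[of 1]]) auto
  then have "u (Suc m) \<in> O(\<lambda>n. real n)" using assms landau_o.big_trans by blast
  then have "(\<lambda>n. real n + u (Suc m) n) \<in> O(\<lambda>n. real n)" by (intro sum_in_bigo) auto
  from landau_o.big.mult[OF Suc this]
  have "(\<lambda>n. ((\<Prod>l<Suc m. real n + u l n) - real n ^ Suc m) * (real n + u (Suc m) n)) \<in>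
      O(\<lambda>n. real n ^ Suc m)" by (simp add: mult.commute)
  moreover have "(\<lambda>n. real n ^ Suc m * u (Suc m) n) \<in> O(\<lambda>n. real n ^ Suc m)"
    using landau_o.big.mult[OF landau_o.big_refl assms, of "\<lambda>n. real n ^ Suc m" "Suc m"] by simp
  ultimately have "(\<lambda>n. ((\<Prod>l<Suc m. real n + u l n) - real n ^ Suc m) * (real n + u (Suc m) n) +
      real n ^ Suc m * u (Suc m) n) \<in> O(\<lambda>n. real n ^ Suc m)"
    by (rule sum_in_bigo)
  also have "(\<lambda>n. ((\<Prod>l<Suc m. real n + u l n) - real n ^ Suc m) * (real n + u (Suc m) n) +
      real n ^ Suc m * u (Suc m) n) = (\<lambda>n. (\<Prod>l<Suc (Suc m). real n + u l n) - real n ^ Suc (Suc m))"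
    by (rule ext) (simp add: algebra_simps)
  finally show ?case .
qed

lemma periodic_bigo_1:
  fixes g :: "nat \<Rightarrow> real"
  assumes "d > 0"
  shows "(\<lambda>n. g (n mod d)) \<in> O(\<lambda>_. 1)"
proof (rule bigoI)
  show "\<forall>\<^sub>F n in at_top. norm (g (n mod d)) \<le> (\<Sum>i<d. \<bar>g i\<bar>) * norm (1::real)"
    using assms by (auto intro!: always_eventually member_le_sum[of _ "{..<d}" "\<lambda>i. \<bar>g i\<bar>"])
qed

text \<open>Independence of the residue is what makes the leading coefficient constant.\<close>

lemma sum_sextic_coeffs:
  assumes "r < 6"
  shows "(\<Sum>i<7. sextic_coeffs ! i ! r) = 4400676"
proof -
  have "r \<in> {0, 1, 2, 3, 4, 5}" using assms by auto
  then show ?thesis by (auto simp: sextic_coeffs_def lessThan_nat_numeral lessThan_Suc)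
qed

lemma pocket_count_asymptotics:
  "(\<lambda>n. real (pocket_count n) - 5821 / 311351040 * real n ^ 6) \<in> O(\<lambda>n. real n ^ 5)"
proof -
  define u where "u i l n = 36 - 6 * real i - 6 * real l - real (n mod 6)" for i l n
  define w where "w i n = real_of_int (sextic_coeffs ! i ! (n mod 6))" for i n
  define e where "e n = 33592320 * (real_of_int (coeffs_26 ! (n mod 26)) +
    real_of_int (coeffs_11 ! (n mod 11)) + real_of_int (coeffs_7 ! (n mod 7)))" for n
  \<comment> \<open>Multiplying by 6^6 = 46656 gives each factor of \<open>falling6\<close> a 6, and
    6 * (n div 6 + 6 - i - l) is \<open>n + u i l n\<close>. Here 235381386240 = 46656 * 5045040,
    and 4400676 / 235381386240 reduces to 5821 / 311351040.\<close>
  have eq: "235381386240 * (real (pocket_count n) - 5821 / 311351040 * real n ^ 6) =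
     (\<Sum>i<7. w i n * ((\<Prod>l<Suc 5. real n + u i l n) - real n ^ Suc 5)) + e n" for n
  proof -
    have "real n = real (6 * (n div 6) + n mod 6)" by simp
    then have n: "real n = 6 * real (n div 6) + real (n mod 6)"
      by (simp only: of_nat_add of_nat_mult of_nat_numeral)
    have falling6: "46656 * real_of_int (falling6 (int (n div 6) + 6 - int i)) =
        (\<Prod>l<Suc 5. real n + u i l n)" for i
      unfolding u_def n by (simp add: falling6_def lessThan_nat_numeral) (simp add: algebra_simps)
    have "(\<Sum>i<7. w i n) = 4400676"
      using arg_cong[OF sum_sextic_coeffs[of "n mod 6"], of real_of_int] by (simp add: w_def)
    then have "(\<Sum>i<7. w i n * real n ^ Suc 5) = 4400676 * real n ^ 6"
      by (simp add: sum_distrib_right[symmetric])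
    moreover have "235381386240 * real (pocket_count n) =
        46656 * real_of_int (5045040 * int (pocket_count n))" by simp
    then have "235381386240 * real (pocket_count n) =
        (\<Sum>i<7. w i n * (\<Prod>l<Suc 5. real n + u i l n)) + e n"
      unfolding pocket_count_falling6 falling6[symmetric]
      by (simp add: sum_distrib_left w_def e_def algebra_simps)
    ultimately show ?thesis
      by (simp add: right_diff_distrib sum_subtractf del: prod.lessThan_Suc)
  qed
  have u: "u i l \<in> O(\<lambda>_. 1)" for i l
    using periodic_bigo_1[of 6 "\<lambda>r. 36 - 6 * real i - 6 * real l - real r"] by (simp add: u_def[abs_def])
  have w: "w i \<in> O(\<lambda>_. 1)" for i
    using periodic_bigo_1[of 6 "\<lambda>r. real_of_int (sextic_coeffs ! i ! r)"] by (simp add: w_def[abs_def])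
  have e: "e \<in> O(\<lambda>_. 1)"
    unfolding e_def[abs_def]
    using periodic_bigo_1[of 26 "\<lambda>r. real_of_int (coeffs_26 ! r)"]
      periodic_bigo_1[of 11 "\<lambda>r. real_of_int (coeffs_11 ! r)"]
      periodic_bigo_1[of 7 "\<lambda>r. real_of_int (coeffs_7 ! r)"]
    by (auto intro!: sum_in_bigo)
  have "(\<lambda>n. w i n * ((\<Prod>l<Suc 5. real n + u i l n) - real n ^ Suc 5)) \<in> O(\<lambda>n. real n ^ 5)" for i
    using landau_o.big.mult[OF w[of i] prod_plus_bounded_bigo[of "u i" 5, OF u]] by simp
  moreover have "(\<lambda>_. 1) \<in> O(\<lambda>n. real n ^ 5)"
    by (intro bigoI[of _ 1] eventually_mono[OF eventually_ge_at_top[of 1]]) auto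
  with e have "e \<in> O(\<lambda>n. real n ^ 5)" using landau_o.big_trans by blast
  ultimately have "(\<lambda>n. 235381386240 * (real (pocket_count n) - 5821 / 311351040 * real n ^ 6)) \<in>
      O(\<lambda>n. real n ^ 5)"
    unfolding eq by (intro sum_in_bigo big_sum_in_bigo) auto
  then show ?thesis by (rule iffD1[OF landau_o.big.cmult_in_iff, rotated]) simp
qed

section \<open>The value at 10^100 and the initial terms\<close>

lemma sum_lessThan_7: "(\<Sum>i<7. h i) = h 0 + h 1 + h 2 + h 3 + h 4 + h 5 + h (6::nat)"
  for h :: "nat \<Rightarrow> int"
  by (simp add: lessThan_nat_numeral lessThan_Suc)

text \<open>The branch of the quasi-polynomial that contains \<open>10 ^ 100\<close>. The factors in
  the proof come from 7 * 311351040 = 432 * 5045040.\<close>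

lemma pocket_count_polynomial:
  assumes "n mod 6 = 4" "n mod 26 = 16" "n mod 11 = 1" "n mod 7 = 4"
  shows "311351040 * int (pocket_count n) =
     5821 * int n^6 + 139704 * int n^5 + 1767760 * int n^4 + 13382400 * int n^3 + 56256624 * int n^2 + 112702976 * int n + 595846400"
proof -
  define x where "x = int (n div 6)"
  have "int n = int (6 * (n div 6) + n mod 6)" by simp
  then have n: "int n = 6 * x + 4"
    unfolding x_def by (simp only: assms(1) of_nat_add of_nat_mult of_nat_numeral)
  have "7 * (311351040 * int (pocket_count n)) = 432 * (5045040 * int (pocket_count n))"
    by simp
  also have "5045040 * int (pocket_count n) = 79186 * falling6 (x + 6 - 0) + 757654 * falling6 (x + 6 - 1) + 2194985 * falling6 (x + 6 - 2) + 1036135 * falling6 (x + 6 - 3) + 398505 * falling6 (x + 6 - 4) + -79483 * falling6 (x + 6 - 5) + 13694 * falling6 (x + 6 - 6) + (-1553760)"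
    unfolding pocket_count_falling6 assms sum_lessThan_7 x_def[symmetric]
    by (simp add: sextic_coeffs_def coeffs_26_def coeffs_11_def coeffs_7_def)
  also have "432 * (79186 * falling6 (x + 6 - 0) + 757654 * falling6 (x + 6 - 1) +
      2194985 * falling6 (x + 6 - 2) + 1036135 * falling6 (x + 6 - 3) + 398505 * falling6 (x + 6 - 4) + -79483 * falling6 (x + 6 - 5) + 13694 * falling6 (x + 6 - 6) + (-1553760)) =
    7 * (5821 * (6 * x + 4)^6 + 139704 * (6 * x + 4)^5 + 1767760 * (6 * x + 4)^4 + 13382400 * (6 * x + 4)^3 + 56256624 * (6 * x + 4)^2 + 112702976 * (6 * x + 4) + 595846400)"
    unfolding falling6_def by algebra
  finally show ?thesis unfolding n by (simp only: mult_cancel_left) simp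
qed

text \<open>
  The value at \<open>10^100\<close> is checked digit block by digit block, that is, in base \<open>10^100\<close> by long
  multiplication with \<open>311351040\<close>.
\<close>

lemma pocket_count_googol:
  "pocket_count (10 ^ 100) = 18695938834827723716612605501494390383279272168161057049945938834827723716612605501494390383279272213031310253532475754697976920199142421364643586865809088031310253532475754697976920199142421364643643642879753990865101976213087324198435309546420657531768642879753990865101976213087324198435309546463639241417019194796972574750352528130305908083685861463639241417019194796972574750352528130305908101754413282191059968837746615524393302171079948857726635504413282191059968837746615524393302171079952477530699752921975144197366419588641810864033086255308477530699752921975144197366419588641810864035"
proof -
  define y :: int where "y = 10 ^ 100"
  \<comment> \<open>Read from the top this is long division by 311351040: the number subtracted in
    each line is the remainder, which re-enters the next line multiplied by
    \<open>y\<close>.\<close>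
  have b5: "311351040 * 186959388348277237166126055014943903832792721681610570499459388348277237166126055014943903832792 = 5821 * y + 139704 - 224836024"
    unfolding y_def by simp
  have b4: "311351040 * 7221303131025353247575469797692019914242136464358686580908803131025353247575469797692019914242136464 = 224836024 * y + 1767760 - 113445200"
    unfolding y_def by simp
  have b3: "311351040 * 3643642879753990865101976213087324198435309546420657531768642879753990865101976213087324198435309546 = 113445200 * y + 13382400 - 144354560"
    unfolding y_def by simp
  have b2: "311351040 * 4636392414170191947969725747503525281303059080836858614636392414170191947969725747503525281303059081 = 144354560 * y + 56256624 - 5462384"
    unfolding y_def by simp
  have b1: "311351040 * 175441328219105996883774661552439330217107994885772663550441328219105996883774661552439330217107995 = 5462384 * y + 112702976 - 77138176"
    unfolding y_def by simp
  have b0: "311351040 * 2477530699752921975144197366419588641810864033086255308477530699752921975144197366419588641810864035 = 77138176 * y + 595846400 - 0"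
    unfolding y_def by simp
  \<comment> \<open>Stated for variables, so that the remainders telescope without expanding the
    long numerals.\<close>
  have combine: "311351040 * (((((b5 * y + b4) * y + b3) * y + b2) * y + b1) * y + b0) =
      5821 * y^6 + 139704 * y^5 + 1767760 * y^4 + 13382400 * y^3 + 56256624 * y^2 + 112702976 * y + 595846400"
    if "311351040 * b5 = 5821 * y + 139704 - 224836024"
      "311351040 * b4 = 224836024 * y + 1767760 - 113445200"
      "311351040 * b3 = 113445200 * y + 13382400 - 144354560"
      "311351040 * b2 = 144354560 * y + 56256624 - 5462384"
      "311351040 * b1 = 5462384 * y + 112702976 - 77138176"
      "311351040 * b0 = 77138176 * y + 595846400 - 0"
    for b0 b1 b2 b3 b4 b5
    using that by algebra
  have "(10 ^ 100 :: nat) mod 6 = 4" "(10 ^ 100 :: nat) mod 26 = 16"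
    "(10 ^ 100 :: nat) mod 11 = 1" "(10 ^ 100 :: nat) mod 7 = 4"
    by simp_all
  from pocket_count_polynomial[OF this]
  have "311351040 * int (pocket_count (10 ^ 100)) =
      5821 * y^6 + 139704 * y^5 + 1767760 * y^4 + 13382400 * y^3 + 56256624 * y^2 + 112702976 * y + 595846400"
    by (simp only: y_def of_nat_power of_nat_numeral)
  also note combine[OF b5 b4 b3 b2 b1 b0, symmetric]
  finally have "int (pocket_count (10 ^ 100)) = ((((186959388348277237166126055014943903832792721681610570499459388348277237166126055014943903832792 * y +
      7221303131025353247575469797692019914242136464358686580908803131025353247575469797692019914242136464) * y +
      3643642879753990865101976213087324198435309546420657531768642879753990865101976213087324198435309546) * y +
      4636392414170191947969725747503525281303059080836858614636392414170191947969725747503525281303059081) * y +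
      175441328219105996883774661552439330217107994885772663550441328219105996883774661552439330217107995) * y +
      2477530699752921975144197366419588641810864033086255308477530699752921975144197366419588641810864035"
    by (simp only: mult_cancel_left) simp
  also have "\<dots> = int 18695938834827723716612605501494390383279272168161057049945938834827723716612605501494390383279272213031310253532475754697976920199142421364643586865809088031310253532475754697976920199142421364643643642879753990865101976213087324198435309546420657531768642879753990865101976213087324198435309546463639241417019194796972574750352528130305908083685861463639241417019194796972574750352528130305908101754413282191059968837746615524393302171079948857726635504413282191059968837746615524393302171079952477530699752921975144197366419588641810864033086255308477530699752921975144197366419588641810864035"
    unfolding y_def by simp
  finally show ?thesis by (simp only: of_nat_eq_iff)
qed

lemma pocket_count_initial:
  "map pocket_count [0..<31] =
         [1, 0, 4, 2, 12, 12, 34, 40, 85, 108, 190, 250, 394, 516, 762, 984, 1385, 1764, 2396, 2998, 3966,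
          4886, 6316, 7684, 9739, 11706, 14594, 17358, 21320, 25134, 30470]"
proof -
  have eq: "pocket_count n = nat (((\<Sum>i<7. sextic_coeffs ! i ! (n mod 6) * falling6 (int (n div 6) + 6 - int i)) +
     720 * (coeffs_26 ! (n mod 26) + coeffs_11 ! (n mod 11) + coeffs_7 ! (n mod 7))) div 5045040)" for n
    unfolding pocket_count_falling6[symmetric] by simp
  show ?thesis
    by (simp add: eq sum_lessThan_7 sextic_coeffs_def coeffs_26_def coeffs_11_def coeffs_7_def
        falling6_def upt_rec)
qed

theorem theorem1:
  shows "Abs_fps (\<lambda>n. of_nat (pocket_count n) :: rat) =
           pocket_numerator fps_X / pocket_denominator fps_X \<and>
         quasi_polynomial (\<lambda>n. of_nat (pocket_count n)) \<and>
         (\<lambda>n. real (pocket_count n) - 5821 / 311351040 * real n ^ 6) \<in> O(\<lambda>n. real n ^ 5) \<and>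
         pocket_count (10 ^ 100) =
           18695938834827723716612605501494390383279272168161057049945938834827723716612605501494390383279272213031310253532475754697976920199142421364643586865809088031310253532475754697976920199142421364643643642879753990865101976213087324198435309546420657531768642879753990865101976213087324198435309546463639241417019194796972574750352528130305908083685861463639241417019194796972574750352528130305908101754413282191059968837746615524393302171079948857726635504413282191059968837746615524393302171079952477530699752921975144197366419588641810864033086255308477530699752921975144197366419588641810864035 \<and>
         map pocket_count [0..<31] =
         [1, 0, 4, 2, 12, 12, 34, 40, 85, 108, 190, 250, 394, 516, 762, 984, 1385, 1764, 2396, 2998, 3966,
          4886, 6316, 7684, 9739, 11706, 14594, 17358, 21320, 25134, 30470]"
proof (intro conjI)
  have "fps_nth (pocket_denominator X) 0 \<noteq> 0"
    by (simp add: pocket_denominator_def)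
  then have "pocket_denominator X \<noteq> 0" by (metis fps_zero_nth)
  then have "Abs_fps (\<lambda>n. of_nat (pocket_count n)) * pocket_denominator X / pocket_denominator X =
      Abs_fps (\<lambda>n. of_nat (pocket_count n))"
    by (rule nonzero_mult_div_cancel_right)
  then show "Abs_fps (\<lambda>n. of_nat (pocket_count n)) = pocket_numerator X / pocket_denominator X"
    by (simp only: pocket_gf_denominator)
qed (rule quasi_polynomial_pocket_count pocket_count_asymptotics pocket_count_googol pocket_count_initial)+

end
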